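(* Let $T\in(0,\infty]$ and $\gamma\in(0,1)$. If there exists $\delta>0$ such that $\varphi\in C^{\gamma+\delta}[0,T)$, then $D_c^\gamma\varphi\in C[0,T)$ and for all $t\in[0,T)$, $$D_c^\gamma\varphi(t)=\frac{1}{\Gamma(1-\gamma)}\left(\frac{\varphi(t)-\varphi(0)}{t^\gamma}+\gamma\int_0^t\frac{\varphi(t)-\varphi(s)}{(t-s)^{\gamma+1}}\,ds\right),$$ where at $t=0$ the right-hand side is understood as its limit as $t\to0^+$.
   Context: $C^{\alpha}[0,T)$ denotes the set of functions that are $\alpha$-Hölder continuous on $[0,T)$. Functions on $[0,T)$ are identified with distributions in $\mathscr D'(-\infty,T)$ by extension by zero to $t<0$. $\theta$ is the Heaviside function and $g_\alpha(t)=\theta(t)t^{\alpha-1}/\Gamma(\alpha)$ for $\alpha>0$. For a continuous function $\varphi$ on $[0,T)$, the Caputo derivative of order $\gamma\in(0,1)$ is the distribution $D_c^\gamma\varphi:=J_{-\gamma}\varphi-\varphi(0)g_{1-\gamma}\in\mathscr D'(-\infty,T)$, where $J_{-\gamma}\varphi$ is the distributional derivative on $(-\infty,T)$ of the function equal to $\frac{1}{\Gamma(1-\gamma)}\int_0^t(t-s)^{-\gamma}\varphi(s)\,ds$ for $0<t<T$ and $0$ for $t<0$. Saying $D_c^\gamma\varphi\in C[0,T)$ means that this distribution is given by a function continuous on $[0,T)$ (extended by zero to $t<0$). *)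

theory Defs
  imports "HOL-Analysis.Analysis"
begin

section \<open>Distributions on an open subset of the real line\<close>

text \<open>
  Elements of a distribution space are functionals that are \<^const>\<open>undefined\<close> outside the
  test functions (\<^const>\<open>extensional\<close>), so that equality of distributions is equality in HOL.
\<close>

definition smooth :: "(real \<Rightarrow> real) \<Rightarrow> bool" where
  "smooth \<psi> \<longleftrightarrow> (\<forall>n x. (deriv ^^ n) \<psi> differentiable at x)"

definition test_functions :: "real set \<Rightarrow> (real \<Rightarrow> real) set" where
  "test_functions U =
     {\<psi>. smooth \<psi> \<and> (\<exists>K. compact K \<and> K \<subseteq> U \<and> (\<forall>x. x \<notin> K \<longrightarrow> \<psi> x = 0))}"

text \<open>
  Continuity is expressed by the usual seminorm estimates: on test functions supported in a given
  compact set, the functional is bounded by finitely many suprema of derivatives.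
\<close>

definition distributions :: "real set \<Rightarrow> ((real \<Rightarrow> real) \<Rightarrow> real) set" where
  "distributions U =
     {D \<in> extensional (test_functions U).
        (\<forall>\<psi>\<in>test_functions U. \<forall>\<eta>\<in>test_functions U. D (\<lambda>x. \<psi> x + \<eta> x) = D \<psi> + D \<eta>) \<and>
        (\<forall>\<psi>\<in>test_functions U. \<forall>c. D (\<lambda>x. c * \<psi> x) = c * D \<psi>) \<and>
        (\<forall>K. compact K \<and> K \<subseteq> U \<longrightarrow>
           (\<exists>C N. \<forall>\<psi>\<in>test_functions U. \<forall>M. (\<forall>x. x \<notin> K \<longrightarrow> \<psi> x = 0) \<longrightarrow>
              (\<forall>n\<le>N. \<forall>x. \<bar>(deriv ^^ n) \<psi> x\<bar> \<le> M) \<longrightarrow> \<bar>D \<psi>\<bar> \<le> C * M))}"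

definition regular_dist :: "real set \<Rightarrow> (real \<Rightarrow> real) \<Rightarrow> (real \<Rightarrow> real) \<Rightarrow> real" where
  "regular_dist U f = (\<lambda>\<psi>\<in>test_functions U. LBINT x:U. f x * \<psi> x)"

definition dist_deriv :: "real set \<Rightarrow> ((real \<Rightarrow> real) \<Rightarrow> real) \<Rightarrow> (real \<Rightarrow> real) \<Rightarrow> real" where
  "dist_deriv U D = (\<lambda>\<psi>\<in>test_functions U. - D (deriv \<psi>))"

section \<open>The Caputo derivative\<close>

text \<open>
  Hoelder continuity is global on \<open>S\<close> and there is no convention of the \<open>C\<^sup>k\<^sup>,\<^sup>\<beta>\<close> kind: on an
  interval, an exponent above 1 leaves only the constant functions.
\<close>

definition holder_space :: "real \<Rightarrow> real set \<Rightarrow> (real \<Rightarrow> real) set" where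
  "holder_space \<alpha> S = {\<phi>. \<exists>C. \<forall>x\<in>S. \<forall>y\<in>S. \<bar>\<phi> x - \<phi> y\<bar> \<le> C * \<bar>x - y\<bar> powr \<alpha>}"

definition ray_below :: "ereal \<Rightarrow> real set" where
  "ray_below T = {t. ereal t < T}"

definition time_interval :: "ereal \<Rightarrow> real set" where
  "time_interval T = {t. 0 \<le> t \<and> ereal t < T}"

definition extend_by_zero :: "(real \<Rightarrow> real) \<Rightarrow> real \<Rightarrow> real" where
  "extend_by_zero f t = (if 0 \<le> t then f t else 0)"

definition g_kernel :: "real \<Rightarrow> real \<Rightarrow> real" where
  "g_kernel \<alpha> t = (if 0 < t then t powr (\<alpha> - 1) / Gamma \<alpha> else 0)"

definition abel_integral :: "real \<Rightarrow> (real \<Rightarrow> real) \<Rightarrow> real \<Rightarrow> real" where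
  "abel_integral \<gamma> \<phi> t =
     (if 0 < t then 1 / Gamma (1 - \<gamma>) * (LBINT s:{0..t}. (t - s) powr (- \<gamma>) * \<phi> s) else 0)"

text \<open>
  Distributions on \<open>(-\<infinity>, T)\<close>. Pairing with test functions supported in \<^term>\<open>ray_below T\<close>
  only involves the values of \<open>\<phi>\<close> on \<^term>\<open>time_interval T\<close>.
\<close>

definition J_neg :: "real \<Rightarrow> ereal \<Rightarrow> (real \<Rightarrow> real) \<Rightarrow> (real \<Rightarrow> real) \<Rightarrow> real" where
  "J_neg \<gamma> T \<phi> = dist_deriv (ray_below T) (regular_dist (ray_below T) (abel_integral \<gamma> \<phi>))"

definition caputo_deriv :: "real \<Rightarrow> ereal \<Rightarrow> (real \<Rightarrow> real) \<Rightarrow> (real \<Rightarrow> real) \<Rightarrow> real" where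
  "caputo_deriv \<gamma> T \<phi> =
     (\<lambda>\<psi>\<in>test_functions (ray_below T).
        J_neg \<gamma> T \<phi> \<psi> - \<phi> 0 * regular_dist (ray_below T) (g_kernel (1 - \<gamma>)) \<psi>)"

section \<open>The functionals above are distributions\<close>

lemma deriv_funpow_add:
  assumes "smooth f" "smooth g"
  shows "(deriv ^^ n) (\<lambda>x. f x + g x) = (\<lambda>x. (deriv ^^ n) f x + (deriv ^^ n) g x)"
proof (induction n)
  case (Suc n)
  have "deriv (\<lambda>x. (deriv ^^ n) f x + (deriv ^^ n) g x) x = (deriv ^^ Suc n) f x + (deriv ^^ Suc n) g x" for x
  proof -
    obtain d e where d: "DERIV ((deriv ^^ n) f) x :> d" and e: "DERIV ((deriv ^^ n) g) x :> e"
      using assms real_differentiableE unfolding smooth_def by metis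
    show ?thesis
      using DERIV_imp_deriv[OF DERIV_add[OF d e]] DERIV_imp_deriv[OF d] DERIV_imp_deriv[OF e] by simp
  qed
  then show ?case by (simp add: Suc fun_eq_iff)
qed simp

lemma deriv_funpow_cmult:
  assumes "smooth f"
  shows "(deriv ^^ n) (\<lambda>x. c * f x) = (\<lambda>x. c * (deriv ^^ n) f x)"
proof (induction n)
  case (Suc n)
  have "deriv (\<lambda>x. c * (deriv ^^ n) f x) x = c * (deriv ^^ Suc n) f x" for x
  proof -
    obtain d where "DERIV ((deriv ^^ n) f) x :> d"
      using assms real_differentiableE unfolding smooth_def by blast
    then show ?thesis
      using DERIV_imp_deriv[OF DERIV_cmult[of "(deriv ^^ n) f" d x UNIV c]] DERIV_imp_deriv by fastforce
  qed
  then show ?case by (simp add: Suc fun_eq_iff)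
qed simp

lemma test_functions_add:
  assumes "f \<in> test_functions U" "g \<in> test_functions U"
  shows "(\<lambda>x. f x + g x) \<in> test_functions U"
proof -
  obtain K L where K: "smooth f" "compact K" "K \<subseteq> U" "\<forall>x. x \<notin> K \<longrightarrow> f x = 0"
    and L: "smooth g" "compact L" "L \<subseteq> U" "\<forall>x. x \<notin> L \<longrightarrow> g x = 0"
    using assms unfolding test_functions_def by blast
  have "smooth (\<lambda>x. f x + g x)"
    unfolding smooth_def deriv_funpow_add[OF K(1) L(1)]
    using K(1) L(1) by (auto simp: smooth_def)
  then show ?thesis
    unfolding test_functions_def using K L by (auto intro!: exI[of _ "K \<union> L"])
qed

lemma test_functions_cmult:
  assumes "f \<in> test_functions U"
  shows "(\<lambda>x. c * f x) \<in> test_functions U"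
proof -
  obtain K where K: "smooth f" "compact K" "K \<subseteq> U" "\<forall>x. x \<notin> K \<longrightarrow> f x = 0"
    using assms unfolding test_functions_def by blast
  have "smooth (\<lambda>x. c * f x)"
    unfolding smooth_def deriv_funpow_cmult[OF K(1)]
    using K(1) by (auto simp: smooth_def)
  then show ?thesis
    unfolding test_functions_def using K by (auto intro!: exI[of _ K])
qed

lemma deriv_zero_outside:
  fixes f :: "real \<Rightarrow> real"
  assumes "compact K" "\<forall>x. x \<notin> K \<longrightarrow> f x = 0" "x \<notin> K"
  shows "deriv f x = 0"
proof -
  have "DERIV f x :> 0 \<longleftrightarrow> DERIV (\<lambda>x. 0) x :> (0::real)"
  proof (rule DERIV_cong_ev)
    have "eventually (\<lambda>y. y \<in> - K) (nhds x)"
      using assms by (intro eventually_nhds_in_open) (auto simp: compact_imp_closed)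
    then show "eventually (\<lambda>y. f y = 0) (nhds x)"
      by eventually_elim (use assms in auto)
  qed auto
  then show ?thesis by (simp add: DERIV_imp_deriv)
qed

lemma test_functions_deriv:
  assumes "f \<in> test_functions U"
  shows "deriv f \<in> test_functions U"
proof -
  obtain K where K: "smooth f" "compact K" "K \<subseteq> U" "\<forall>x. x \<notin> K \<longrightarrow> f x = 0"
    using assms unfolding test_functions_def by blast
  have "smooth (deriv f)"
    unfolding smooth_def
  proof (intro allI)
    fix n x
    have "(deriv ^^ Suc n) f differentiable at x" using K(1) unfolding smooth_def by blast
    then show "(deriv ^^ n) (deriv f) differentiable at x" by (simp add: funpow_swap1)
  qed
  then show ?thesis
    unfolding test_functions_def using K deriv_zero_outside[OF K(2,4)]
    by (auto intro!: exI[of _ K])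
qed

lemma test_function_continuous:
  assumes "f \<in> test_functions U"
  shows "continuous_on A f"
proof -
  have "f differentiable at x" for x
    using assms unfolding test_functions_def smooth_def by (auto dest: spec[of _ 0])
  then show ?thesis
    by (simp add: continuous_at_imp_continuous_on differentiable_imp_continuous_within)
qed

lemma test_pairing:
  assumes f: "set_integrable lborel K f" and K: "compact K" "K \<subseteq> U"
    and \<psi>: "\<psi> \<in> test_functions U" "\<forall>x. x \<notin> K \<longrightarrow> \<psi> x = 0"
  shows "set_integrable lborel U (\<lambda>x. f x * \<psi> x)"
    and "(LBINT x:U. f x * \<psi> x) = (LBINT x:K. f x * \<psi> x)"
    and "(\<forall>x. \<bar>\<psi> x\<bar> \<le> M) \<Longrightarrow> \<bar>LBINT x:U. f x * \<psi> x\<bar> \<le> (LBINT x:K. \<bar>f x\<bar>) * M"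
proof -
  have eq: "(\<lambda>x. indicat_real U x *\<^sub>R (f x * \<psi> x)) = (\<lambda>x. indicat_real K x *\<^sub>R (f x * \<psi> x))"
    using K \<psi> by (auto simp: fun_eq_iff indicator_def)
  have cont: "continuous_on UNIV \<psi>" using test_function_continuous[OF \<psi>(1)] .
  then have meas: "\<psi> \<in> borel_measurable borel" by (rule borel_measurable_continuous_onI)
  have "bounded (\<psi> ` K)"
    using compact_continuous_image[OF test_function_continuous[OF \<psi>(1)] K(1)] compact_imp_bounded by blast
  then obtain B where B: "\<And>x. x \<in> K \<Longrightarrow> \<bar>\<psi> x\<bar> \<le> B" "B > 0" unfolding bounded_pos by auto
  have B': "\<bar>\<psi> x\<bar> \<le> B" for x using B \<psi>(2) by (cases "x \<in> K") auto
  have ind: "integrable lborel (\<lambda>x. indicat_real K x *\<^sub>R f x)"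
    using f unfolding set_integrable_def .
  have int: "integrable lborel (\<lambda>x. indicat_real K x *\<^sub>R (f x * \<psi> x))"
  proof (rule Bochner_Integration.integrable_bound[OF integrable_mult_right[OF ind, of B]])
    have "(\<lambda>x. (indicat_real K x *\<^sub>R f x) * \<psi> x) \<in> borel_measurable lborel"
      using borel_measurable_integrable[OF ind] meas by (intro borel_measurable_times) auto
    then show "(\<lambda>x. indicat_real K x *\<^sub>R (f x * \<psi> x)) \<in> borel_measurable lborel"
      by (simp add: mult.assoc)
    show "AE x in lborel. norm (indicat_real K x *\<^sub>R (f x * \<psi> x)) \<le> norm (B * (indicat_real K x *\<^sub>R f x))"
      using B' B(2) by (intro AE_I2) (auto simp: indicator_def abs_mult mult.commute mult_right_mono)
  qed
  then show 1: "set_integrable lborel U (\<lambda>x. f x * \<psi> x)"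
    unfolding set_integrable_def eq .
  show 2: "(LBINT x:U. f x * \<psi> x) = (LBINT x:K. f x * \<psi> x)"
    unfolding set_lebesgue_integral_def eq ..
  assume M: "\<forall>x. \<bar>\<psi> x\<bar> \<le> M"
  have "\<bar>LBINT x:U. f x * \<psi> x\<bar> \<le> (\<integral>x. M * \<bar>indicat_real K x *\<^sub>R f x\<bar> \<partial>lborel)"
    unfolding 2 unfolding set_lebesgue_integral_def
  proof (rule order_trans[OF integral_abs_bound], rule integral_mono)
    show "integrable lborel (\<lambda>x. \<bar>indicat_real K x *\<^sub>R (f x * \<psi> x)\<bar>)" using int by (rule integrable_abs)
    show "integrable lborel (\<lambda>x. M * \<bar>indicat_real K x *\<^sub>R f x\<bar>)"
      using ind by (intro integrable_mult_right integrable_abs)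
    show "\<bar>indicat_real K x *\<^sub>R (f x * \<psi> x)\<bar> \<le> M * \<bar>indicat_real K x *\<^sub>R f x\<bar>" for x
      using M by (auto simp: indicator_def abs_mult mult.commute mult_right_mono)
  qed
  also have "\<dots> = (LBINT x:K. \<bar>f x\<bar>) * M"
    unfolding set_lebesgue_integral_def by (simp add: abs_mult mult.commute)
  finally show "\<bar>LBINT x:U. f x * \<psi> x\<bar> \<le> (LBINT x:K. \<bar>f x\<bar>) * M" .
qed

lemma regular_dist_in_distributions:
  assumes f: "\<And>K. compact K \<Longrightarrow> K \<subseteq> U \<Longrightarrow> set_integrable lborel K f"
  shows "regular_dist U f \<in> distributions U"
proof -
  have si: "set_integrable lborel U (\<lambda>x. f x * \<psi> x)" if p: "\<psi> \<in> test_functions U" for \<psi>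
  proof -
    obtain K where K: "compact K" "K \<subseteq> U" "\<forall>x. x \<notin> K \<longrightarrow> \<psi> x = 0"
      using p unfolding test_functions_def by blast
    show ?thesis using test_pairing(1)[OF f[OF K(1,2)] K(1,2) p K(3)] .
  qed
  show ?thesis
    unfolding distributions_def mem_Collect_eq
  proof (intro conjI ballI allI impI)
    fix \<psi> \<eta> assume p: "\<psi> \<in> test_functions U" "\<eta> \<in> test_functions U"
    show "regular_dist U f (\<lambda>x. \<psi> x + \<eta> x) = regular_dist U f \<psi> + regular_dist U f \<eta>"
      using p test_functions_add[OF p] set_integral_add(2)[OF si[OF p(1)] si[OF p(2)]]
      by (simp add: regular_dist_def distrib_left)
  next
    fix \<psi> c assume p: "\<psi> \<in> test_functions U"
    show "regular_dist U f (\<lambda>x. c * \<psi> x) = c * regular_dist U f \<psi>"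
      using p test_functions_cmult[OF p]
      by (simp add: regular_dist_def mult.left_commute[of _ c])
  next
    fix K :: "real set" assume K: "compact K \<and> K \<subseteq> U"
    show "\<exists>C N. \<forall>\<psi>\<in>test_functions U. \<forall>M. (\<forall>x. x \<notin> K \<longrightarrow> \<psi> x = 0) \<longrightarrow>
              (\<forall>n\<le>N. \<forall>x. \<bar>(deriv ^^ n) \<psi> x\<bar> \<le> M) \<longrightarrow> \<bar>regular_dist U f \<psi>\<bar> \<le> C * M"
    proof (rule exI[of _ "LBINT x:K. \<bar>f x\<bar>"], rule exI[of _ 0], intro ballI allI impI)
      fix \<psi> M assume p: "\<psi> \<in> test_functions U" "\<forall>x. x \<notin> K \<longrightarrow> \<psi> x = 0"
        "\<forall>n\<le>0. \<forall>x. \<bar>(deriv ^^ n) \<psi> x\<bar> \<le> M"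
      show "\<bar>regular_dist U f \<psi>\<bar> \<le> (LBINT x:K. \<bar>f x\<bar>) * M"
        using test_pairing(3)[OF f _ _ p(1,2)] K p by (simp add: regular_dist_def)
    qed
  qed (simp add: regular_dist_def)
qed

lemma distributions_bound:
  assumes "D \<in> distributions U" "compact K \<and> K \<subseteq> U"
  shows "\<exists>C N. \<forall>\<psi>\<in>test_functions U. \<forall>M. (\<forall>x. x \<notin> K \<longrightarrow> \<psi> x = 0) \<longrightarrow>
              (\<forall>n\<le>N. \<forall>x. \<bar>(deriv ^^ n) \<psi> x\<bar> \<le> M) \<longrightarrow> \<bar>D \<psi>\<bar> \<le> C * M"
  using assms(1)[unfolded distributions_def mem_Collect_eq, THEN conjunct2, THEN conjunct2,
      THEN conjunct2, rule_format, OF assms(2)] .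

lemma dist_deriv_in_distributions:
  assumes D: "D \<in> distributions U"
  shows "dist_deriv U D \<in> distributions U"
proof -
  note D' = D[unfolded distributions_def mem_Collect_eq]
  have sm: "smooth \<psi>" if "\<psi> \<in> test_functions U" for \<psi>
    using that by (simp add: test_functions_def)
  show ?thesis
    unfolding distributions_def mem_Collect_eq
  proof (intro conjI ballI allI impI)
    fix \<psi> \<eta> assume p: "\<psi> \<in> test_functions U" "\<eta> \<in> test_functions U"
    show "dist_deriv U D (\<lambda>x. \<psi> x + \<eta> x) = dist_deriv U D \<psi> + dist_deriv U D \<eta>"
      using p test_functions_add[OF p] deriv_funpow_add[OF sm sm, OF p, of 1] D'
        test_functions_deriv[OF p(1)] test_functions_deriv[OF p(2)]
      by (simp add: dist_deriv_def)
  next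
    fix \<psi> c assume p: "\<psi> \<in> test_functions U"
    show "dist_deriv U D (\<lambda>x. c * \<psi> x) = c * dist_deriv U D \<psi>"
      using p test_functions_cmult[OF p] deriv_funpow_cmult[OF sm, OF p, of 1 c] D'
        test_functions_deriv[OF p(1)]
      by (simp add: dist_deriv_def)
  next
    fix K :: "real set" assume K: "compact K \<and> K \<subseteq> U"
    obtain C N where CN0: "\<forall>\<psi>\<in>test_functions U. \<forall>M. (\<forall>x. x \<notin> K \<longrightarrow> \<psi> x = 0) \<longrightarrow>
              (\<forall>n\<le>N. \<forall>x. \<bar>(deriv ^^ n) \<psi> x\<bar> \<le> M) \<longrightarrow> \<bar>D \<psi>\<bar> \<le> C * M"
      using distributions_bound[OF D K] by (elim exE)
    note CN = CN0[THEN bspec, THEN spec, THEN mp, THEN mp]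
    show "\<exists>C N. \<forall>\<psi>\<in>test_functions U. \<forall>M. (\<forall>x. x \<notin> K \<longrightarrow> \<psi> x = 0) \<longrightarrow>
              (\<forall>n\<le>N. \<forall>x. \<bar>(deriv ^^ n) \<psi> x\<bar> \<le> M) \<longrightarrow> \<bar>dist_deriv U D \<psi>\<bar> \<le> C * M"
    proof (rule exI[of _ C], rule exI[of _ "Suc N"], intro ballI allI impI)
      fix \<psi> M assume p: "\<psi> \<in> test_functions U" "\<forall>x. x \<notin> K \<longrightarrow> \<psi> x = 0"
        "\<forall>n\<le>Suc N. \<forall>x. \<bar>(deriv ^^ n) \<psi> x\<bar> \<le> M"
      have "\<bar>(deriv ^^ n) (deriv \<psi>) x\<bar> \<le> M" if "n \<le> N" for n x
        using p(3)[rule_format, of "Suc n" x] that by (simp add: funpow_swap1)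
      then have "\<bar>D (deriv \<psi>)\<bar> \<le> C * M"
        using CN[OF test_functions_deriv[OF p(1)]] deriv_zero_outside[of K \<psi>] K p(2) by blast
      then show "\<bar>dist_deriv U D \<psi>\<bar> \<le> C * M" using p by (simp add: dist_deriv_def)
    qed
  qed (simp add: dist_deriv_def)
qed

lemma distributions_diff_scaled:
  assumes D: "D \<in> distributions U" and E: "E \<in> distributions U"
  shows "(\<lambda>\<psi>\<in>test_functions U. D \<psi> - c * E \<psi>) \<in> distributions U"
proof -
  note D' = D[unfolded distributions_def mem_Collect_eq]
  note E' = E[unfolded distributions_def mem_Collect_eq]
  show ?thesis
    unfolding distributions_def mem_Collect_eq
  proof (intro conjI ballI allI impI)
    fix K :: "real set" assume K: "compact K \<and> K \<subseteq> U"
    obtain C N where CN0: "\<forall>\<psi>\<in>test_functions U. \<forall>M. (\<forall>x. x \<notin> K \<longrightarrow> \<psi> x = 0) \<longrightarrow>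
              (\<forall>n\<le>N. \<forall>x. \<bar>(deriv ^^ n) \<psi> x\<bar> \<le> M) \<longrightarrow> \<bar>D \<psi>\<bar> \<le> C * M"
      using distributions_bound[OF D K] by (elim exE)
    note CN = CN0[THEN bspec, THEN spec, THEN mp, THEN mp]
    obtain C' N' where CN'0: "\<forall>\<psi>\<in>test_functions U. \<forall>M. (\<forall>x. x \<notin> K \<longrightarrow> \<psi> x = 0) \<longrightarrow>
              (\<forall>n\<le>N'. \<forall>x. \<bar>(deriv ^^ n) \<psi> x\<bar> \<le> M) \<longrightarrow> \<bar>E \<psi>\<bar> \<le> C' * M"
      using distributions_bound[OF E K] by (elim exE)
    note CN' = CN'0[THEN bspec, THEN spec, THEN mp, THEN mp]
    show "\<exists>C N. \<forall>\<psi>\<in>test_functions U. \<forall>M. (\<forall>x. x \<notin> K \<longrightarrow> \<psi> x = 0) \<longrightarrow>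
              (\<forall>n\<le>N. \<forall>x. \<bar>(deriv ^^ n) \<psi> x\<bar> \<le> M) \<longrightarrow>
              \<bar>(\<lambda>\<psi>\<in>test_functions U. D \<psi> - c * E \<psi>) \<psi>\<bar> \<le> C * M"
    proof (rule exI[of _ "C + \<bar>c\<bar> * C'"], rule exI[of _ "max N N'"], intro ballI allI impI)
      fix \<psi> M assume p: "\<psi> \<in> test_functions U" "\<forall>x. x \<notin> K \<longrightarrow> \<psi> x = 0"
        "\<forall>n\<le>max N N'. \<forall>x. \<bar>(deriv ^^ n) \<psi> x\<bar> \<le> M"
      have "\<bar>D \<psi>\<bar> \<le> C * M" "\<bar>E \<psi>\<bar> \<le> C' * M"
        using CN[OF p(1,2), of M] CN'[OF p(1,2), of M] p(3) by auto
      moreover from this(2) have "\<bar>c * E \<psi>\<bar> \<le> \<bar>c\<bar> * (C' * M)"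
        by (simp add: abs_mult mult_left_mono)
      ultimately have "\<bar>D \<psi> - c * E \<psi>\<bar> \<le> C * M + \<bar>c\<bar> * (C' * M)" by linarith
      then show "\<bar>(\<lambda>\<psi>\<in>test_functions U. D \<psi> - c * E \<psi>) \<psi>\<bar> \<le> (C + \<bar>c\<bar> * C') * M"
        using p(1) by (simp add: algebra_simps)
    qed
  qed (use D' E' test_functions_add test_functions_cmult in \<open>auto simp: algebra_simps\<close>)
qed

lemma set_integrable_powr_from_0:
  fixes a b :: real
  assumes "a > - 1"
  shows "set_integrable lborel {0..b} (\<lambda>x. x powr a)"
proof (cases "0 \<le> b")
  case True
  have "(\<lambda>x. x powr a) absolutely_integrable_on {0..b}"
    using integrable_on_powr_from_0[OF assms True]
    by (intro nonnegative_absolutely_integrable_1) auto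
  then show ?thesis
    unfolding set_integrable_def by (subst (asm) integrable_completion) auto
qed (simp add: set_integrable_def)

lemma ray_below_compactE:
  assumes "compact K" "K \<subseteq> ray_below T" "0 < T"
  obtains a b where "K \<subseteq> {a..b}" "0 < b" "ereal b < T"
proof -
  obtain c :: real where c: "0 < c" "ereal c < T"
    using ereal_dense2[OF assms(3)] by (auto simp: zero_ereal_def)
  obtain a where a: "\<And>x. x \<in> K \<Longrightarrow> a \<le> x"
    using assms(1) compact_imp_bounded by (metis bounded_imp_bdd_below bdd_below_def)
  show ?thesis
  proof (cases "K = {}")
    case True
    then show ?thesis using that[of 0 c] c by auto
  next
    case False
    then obtain m where m: "m \<in> K" "\<And>x. x \<in> K \<Longrightarrow> x \<le> m"
      using compact_attains_sup[OF assms(1)] by blast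
    have "ereal (max m c) < T" using m(1) assms(2) c by (auto simp: ray_below_def max_def)
    then show ?thesis using that[of a "max m c"] a m c by (force simp: le_max_iff_disj)
  qed
qed

lemma g_kernel_locally_integrable:
  assumes "\<alpha> > 0" "compact K"
  shows "set_integrable lborel K (g_kernel \<alpha>)"
proof -
  obtain b where b: "\<And>x. x \<in> K \<Longrightarrow> x \<le> b"
    using assms(2) compact_imp_bounded by (metis bounded_imp_bdd_above bdd_above_def)
  have "set_integrable lborel {0..b} (\<lambda>x. x powr (\<alpha> - 1) / Gamma \<alpha>)"
    using set_integrable_powr_from_0[of "\<alpha> - 1" b] assms by auto
  then have "set_integrable lborel (K \<inter> {0..b}) (\<lambda>x. x powr (\<alpha> - 1) / Gamma \<alpha>)"
    using assms(2) by (rule_tac set_integrable_subset) (auto simp: compact_imp_closed)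
  moreover have "indicat_real (K \<inter> {0..b}) x *\<^sub>R (x powr (\<alpha> - 1) / Gamma \<alpha>) =
      indicat_real K x *\<^sub>R g_kernel \<alpha> x" for x
    using b by (auto simp: indicator_def g_kernel_def)
  ultimately show ?thesis unfolding set_integrable_def by simp
qed

lemma abel_integral_locally_integrable:
  assumes "\<gamma> < 1" "0 < T" "continuous_on (time_interval T) \<phi>" "compact K" "K \<subseteq> ray_below T"
  shows "set_integrable lborel K (abel_integral \<gamma> \<phi>)"
proof -
  obtain a b where ab: "K \<subseteq> {a..b}" "0 < b" "ereal b < T"
    using ray_below_compactE[OF assms(4,5,2)] .
  define h where "h = (\<lambda>s. indicat_real {0..b} s * \<phi> s)"
  have sub: "{0..b} \<subseteq> time_interval T"
    using ab(3) by (auto simp: time_interval_def intro: le_less_trans[of _ "ereal b"])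
  have cont: "continuous_on {0..b} \<phi>" by (rule continuous_on_subset[OF assms(3) sub])
  have hm[measurable]: "h \<in> borel_measurable borel"
    using borel_measurable_continuous_on_indicator[OF _ cont] by (simp add: h_def)
  obtain M where M: "0 < M" "\<And>s. s \<in> {0..b} \<Longrightarrow> \<bar>\<phi> s\<bar> \<le> M"
    using compact_imp_bounded[OF compact_continuous_image[OF cont compact_Icc]]
    unfolding bounded_pos by auto
  define P where "P = (\<lambda>u::real. indicat_real {0..b} u * u powr (- \<gamma>))"
  have P: "integrable lborel P"
    using set_integrable_powr_from_0[of "- \<gamma>" b] assms(1) by (simp add: P_def set_integrable_def)
  define F where "F = (\<lambda>t. 1 / Gamma (1 - \<gamma>) *
     (\<integral>s. (if s \<in> {0..t} then (t - s) powr (- \<gamma>) * h s else 0) \<partial>lborel))"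
  have Fm[measurable]: "F \<in> borel_measurable borel"
  proof -
    have "(\<lambda>(t, s). if s \<in> {0..t} then (t - s) powr (- \<gamma>) * h s else 0)
        \<in> borel_measurable (borel \<Otimes>\<^sub>M lborel)"
      unfolding atLeastAtMost_iff by measurable
    then show ?thesis
      unfolding F_def by (intro borel_measurable_times borel_measurable_const
          lborel.borel_measurable_lebesgue_integral) auto
  qed
  have eq: "abel_integral \<gamma> \<phi> t = (if 0 < t then F t else 0)" if "t \<le> b" for t
    using that unfolding abel_integral_def F_def set_lebesgue_integral_def h_def
    by (auto intro!: Bochner_Integration.integral_cong simp: indicator_def)
  have bound: "\<bar>F t\<bar> \<le> \<bar>1 / Gamma (1 - \<gamma>)\<bar> * (M * integral\<^sup>L lborel P)" if "t \<le> b" for t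
  proof -
    have Pt: "integrable lborel (\<lambda>s. P (t + (- 1) * s))"
      using lborel_integrable_real_affine[OF P, of "-1" t] by simp
    have It: "integral\<^sup>L lborel P = (\<integral>s. P (t + (- 1) * s) \<partial>lborel)"
      using lborel_integral_real_affine[of "-1" P t] by simp
    have "\<bar>\<integral>s. (if s \<in> {0..t} then (t - s) powr (- \<gamma>) * h s else 0) \<partial>lborel\<bar>
        \<le> (\<integral>s. M * P (t + (- 1) * s) \<partial>lborel)"
    proof (rule integral_abs_bound_integral)
      have *: "\<bar>if s \<in> {0..t} then (t - s) powr (- \<gamma>) * h s else 0\<bar> \<le> M * P (t + (- 1) * s)" for s
        using M that by (auto simp: P_def h_def indicator_def abs_mult mult.commute mult_right_mono)
      show "\<And>s. \<bar>if s \<in> {0..t} then (t - s) powr (- \<gamma>) * h s else 0\<bar> \<le> M * P (t + (- 1) * s)"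
        using * .
      show g: "integrable lborel (\<lambda>s. M * P (t + (- 1) * s))" using Pt by simp
      show "integrable lborel (\<lambda>s. if s \<in> {0..t} then (t - s) powr (- \<gamma>) * h s else 0)"
      proof (rule Bochner_Integration.integrable_bound[OF g])
        show "(\<lambda>s. if s \<in> {0..t} then (t - s) powr (- \<gamma>) * h s else 0) \<in> borel_measurable lborel"
          by measurable
        show "AE s in lborel. norm (if s \<in> {0..t} then (t - s) powr (- \<gamma>) * h s else 0)
            \<le> norm (M * P (t + (- 1) * s))"
          unfolding real_norm_def by (intro AE_I2 order_trans[OF * abs_ge_self])
      qed
    qed
    then have "\<bar>\<integral>s. (if s \<in> {0..t} then (t - s) powr (- \<gamma>) * h s else 0) \<partial>lborel\<bar>
        \<le> M * integral\<^sup>L lborel P"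
      by (simp add: It)
    then show ?thesis
      unfolding F_def abs_mult by (intro mult_left_mono) auto
  qed
  have "integrable lborel (\<lambda>t. indicat_real K t *\<^sub>R (if 0 < t then F t else 0))"
  proof (rule Bochner_Integration.integrable_bound)
    have K: "K \<in> sets lborel" using assms(4) by (simp add: compact_imp_closed)
    show "integrable lborel (\<lambda>t. indicat_real K t * (\<bar>1 / Gamma (1 - \<gamma>)\<bar> * (M * integral\<^sup>L lborel P)))"
      using emeasure_compact_finite[OF assms(4)] K by auto
    show "(\<lambda>t. indicat_real K t *\<^sub>R (if 0 < t then F t else 0)) \<in> borel_measurable lborel"
      using K by measurable
    show "AE t in lborel. norm (indicat_real K t *\<^sub>R (if 0 < t then F t else 0)) \<le>
        norm (indicat_real K t * (\<bar>1 / Gamma (1 - \<gamma>)\<bar> * (M * integral\<^sup>L lborel P)))"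
    proof (rule AE_I2)
      fix t
      define B where "B = \<bar>1 / Gamma (1 - \<gamma>)\<bar> * (M * integral\<^sup>L lborel P)"
      show "norm (indicat_real K t *\<^sub>R (if 0 < t then F t else 0)) \<le>
        norm (indicat_real K t * (\<bar>1 / Gamma (1 - \<gamma>)\<bar> * (M * integral\<^sup>L lborel P)))"
        unfolding B_def[symmetric] using bound[of t, folded B_def] ab(1)
        by (cases "t \<in> K") auto
    qed
  qed
  moreover have "indicat_real K t *\<^sub>R (if 0 < t then F t else 0) =
      indicat_real K t *\<^sub>R abel_integral \<gamma> \<phi> t" for t
    using eq[of t] ab(1) by (cases "t \<in> K") auto
  ultimately show ?thesis unfolding set_integrable_def by (simp only:)
qed

lemma caputo_deriv_in_distributions:
  assumes "\<gamma> < 1" "0 < T" "continuous_on (time_interval T) \<phi>"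
  shows "caputo_deriv \<gamma> T \<phi> \<in> distributions (ray_below T)"
  unfolding caputo_deriv_def J_neg_def
  using assms
  by (intro distributions_diff_scaled dist_deriv_in_distributions regular_dist_in_distributions
      abel_integral_locally_integrable g_kernel_locally_integrable) auto

end

theory Submission
  imports Defs
begin

text \<open>
  On \<open>[0, b]\<close> with \<open>b < T\<close>, the function \<open>w = \<phi> - \<phi>(0)\<close>, truncated at \<open>b\<close> and extended by zero to
  \<open>t < 0\<close>, is bounded and Hoelder continuous on the whole line. Since \<open>\<gamma> \<integral>\<^sub>t\<^sup>\<infinity> r\<^sup>-\<^sup>\<gamma>\<^sup>-\<^sup>1 dr = t\<^sup>-\<^sup>\<gamma>\<close>, the
  right-hand side of the formula is a constant multiple of the Marchaud integral
  \<open>\<integral>\<^sub>0\<^sup>\<infinity> (w(t) - w(t - r)) r\<^sup>-\<^sup>\<gamma>\<^sup>-\<^sup>1 dr\<close>, which is continuous in \<open>t\<close> by dominated convergence. Two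
  applications of Fubini's theorem show that its antiderivative is the Abel integral of \<open>w\<close>, so the
  Abel integral of \<open>\<phi>\<close> is continuously differentiable on \<open>(0, b)\<close> up to the explicit contribution of
  \<open>\<phi>(0)\<close>; integrating by parts against a test function gives the distributional identity.
\<close>

section \<open>Power tails and reflected integrals\<close>

text \<open>With \<open>e = - \<gamma> - 1\<close> this produces both the boundary term
  \<open>t powr (- \<gamma>)\<close> of the formula and the Abel kernel, each with a factor
  \<open>1 / \<gamma>\<close>.\<close>

lemma set_integral_powr_tail:
  fixes a e :: real
  assumes "e < - 1" "0 < a"
  shows "set_integrable lborel {a..} (\<lambda>x. x powr e)"
    and "(LBINT x:{a..}. x powr e) = - (a powr (e + 1)) / (e + 1)"
proof -
  \<comment> \<open>Nonnegativity upgrades gauge integrability to Lebesgue integrability over the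
    completed measure; Borel measurability then brings it down to \<open>lborel\<close>.\<close>
  have "(\<lambda>x. x powr e) absolutely_integrable_on {a..}"
    using has_integral_powr_to_inf[OF assms] 
    by (intro nonnegative_absolutely_integrable_1) (auto simp: integrable_on_def)
  then show 1: "set_integrable lborel {a..} (\<lambda>x. x powr e)"
    unfolding set_integrable_def by (subst (asm) integrable_completion) auto
  show "(LBINT x:{a..}. x powr e) = - (a powr (e + 1)) / (e + 1)"
    using has_integral_powr_to_inf[OF assms] set_borel_integral_eq_integral(2)[OF 1]
    by (simp add: integral_unique)
qed

text \<open>The substitution \<open>r = t - s\<close> maps \<open>{0..t}\<close> to itself and moves
  the kernel singularity from \<open>s = t\<close> to \<open>r = 0\<close>.\<close>

lemma set_integral_reflect:
  fixes h :: "real \<Rightarrow> real"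
  shows "set_integrable lborel {0..t} (\<lambda>s. h (t - s)) \<longleftrightarrow> set_integrable lborel {0..t} h"
    and "(LBINT s:{0..t}. h (t - s)) = (LBINT r:{0..t}. h r)"
proof -
  have eq: "indicat_real {0..t} (t + - 1 * s) *\<^sub>R h (t + - 1 * s) = indicat_real {0..t} s *\<^sub>R h (t - s)" for s
    by (auto simp: indicator_def)
  show "set_integrable lborel {0..t} (\<lambda>s. h (t - s)) \<longleftrightarrow> set_integrable lborel {0..t} h"
    using lborel_integrable_real_affine_iff[of "-1" "\<lambda>r. indicat_real {0..t} r *\<^sub>R h r" t]
    unfolding set_integrable_def eq by simp
  show "(LBINT s:{0..t}. h (t - s)) = (LBINT r:{0..t}. h r)"
    using lborel_integral_real_affine[of "-1" "\<lambda>r. indicat_real {0..t} r *\<^sub>R h r" t]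
    unfolding set_lebesgue_integral_def eq by simp
qed

lemma set_integral_Icc_Ico:
  fixes f :: "real \<Rightarrow> real"
  assumes "a \<le> b"
  shows "(LBINT x:{a..b}. f x) = (LBINT x:{a..<b}. f x)"
  using interval_integral_Icc[OF assms, of f] interval_integral_Ico[OF assms, of f] by simp

section \<open>The Marchaud integral of a bounded causal Hoelder function\<close>

text \<open>The Marchaud fractional derivative without its factor
  \<open>\<gamma> / Gamma (1 - \<gamma>)\<close>.\<close>

definition marchaud :: "real \<Rightarrow> (real \<Rightarrow> real) \<Rightarrow> real \<Rightarrow> real" where
  "marchaud \<gamma> w t = (LBINT r:{0..}. (w t - w (t - r)) / r powr (\<gamma> + 1))"

text \<open>The Hoelder bound with \<open>\<gamma> < \<alpha>\<close> tames
  \<open>r powr (- \<gamma> - 1)\<close> near \<open>0\<close>, boundedness does so at infinity, and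
  causality collapses the range \<open>r \<ge> t\<close>. All bounds hold on the whole line, so
  translates of \<open>w\<close> need no domain conditions.\<close>

locale bounded_causal_holder =
  fixes \<gamma> \<alpha> C M :: real and w :: "real \<Rightarrow> real"
  assumes gamma: "0 < \<gamma>" "\<gamma> < 1" "\<gamma> < \<alpha>"
    and holder: "\<bar>w x - w y\<bar> \<le> C * \<bar>x - y\<bar> powr \<alpha>"
    and bounded: "\<bar>w x\<bar> \<le> M"
    and causal: "x \<le> 0 \<Longrightarrow> w x = 0"
begin

lemma C_nonneg: "0 \<le> C" and M_nonneg: "0 \<le> M"
  using holder[of 1 0] bounded[of 0] by auto

lemma continuous: "continuous_on A w"
proof -
  have "isCont w x" for x
  proof -
    have "((\<lambda>y. C * \<bar>y - x\<bar> powr \<alpha>) \<longlongrightarrow> C * 0) (at x)"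
    proof (intro tendsto_mult tendsto_const tendsto_zero_powrI[where b = \<alpha>] always_eventually allI)
      show "((\<lambda>y. \<bar>y - x\<bar>) \<longlongrightarrow> 0) (at x)"
        by (intro tendsto_rabs_zero LIM_zero tendsto_ident_at)
    qed (use gamma in auto)
    then have "((\<lambda>y. w y - w x) \<longlongrightarrow> 0) (at x)"
      by (rule_tac Lim_null_comparison[where g = "\<lambda>y. C * \<bar>y - x\<bar> powr \<alpha>"])
        (use holder in auto)
    then show ?thesis by (simp add: isCont_def Lim_null[symmetric])
  qed
  then show ?thesis by (simp add: continuous_at_imp_continuous_on)
qed

lemma measurable_w[measurable]: "w \<in> borel_measurable borel"
  by (rule borel_measurable_continuous_onI[OF continuous])

text \<open>A bound that is uniform in \<open>t\<close>: the Hoelder estimate below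
  \<open>1\<close>, the sup bound above. The overlap at \<open>r = 1\<close> only enlarges
  it.\<close>

definition majorant :: "real \<Rightarrow> real" where
  "majorant r = indicat_real {0..1} r * (C * r powr (\<alpha> - \<gamma> - 1)) +
     indicat_real {1..} r * (2 * M * r powr (- \<gamma> - 1))"

lemma integrable_majorant: "integrable lborel majorant"
proof -
  have "set_integrable lborel {0..1} (\<lambda>r. C * r powr (\<alpha> - \<gamma> - 1))"
    "set_integrable lborel {1..} (\<lambda>r. 2 * M * r powr (- \<gamma> - 1))"
    using gamma by (auto intro!: set_integrable_mult_right set_integrable_powr_from_0 set_integral_powr_tail)
  then show ?thesis
    unfolding majorant_def set_integrable_def by (auto intro: Bochner_Integration.integrable_add)
qed

lemma quotient_le_majorant:
  "\<bar>indicat_real {0..} r * ((w t - w (t - r)) / r powr (\<gamma> + 1))\<bar> \<le> majorant r"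
proof -
  have pos: "0 \<le> majorant r" using C_nonneg M_nonneg by (simp add: majorant_def)
  show ?thesis
  proof (cases "r \<le> 0")
    case True
    \<comment> \<open>For \<open>r < 0\<close> the indicator vanishes, at \<open>r = 0\<close> the
      numerator does.\<close>
    with pos show ?thesis by (cases "r = 0") auto
  next
    case False
    have "\<bar>w t - w (t - r)\<bar> \<le> C * r powr \<alpha>" using holder[of t "t - r"] False by simp
    then have 1: "\<bar>w t - w (t - r)\<bar> / r powr (\<gamma> + 1) \<le> C * r powr (\<alpha> - \<gamma> - 1)"
      using False powr_diff[of r \<alpha> "\<gamma> + 1"]
      by (simp add: divide_right_mono diff_diff_eq flip: times_divide_eq_right)
         (metis divide_right_mono powr_ge_zero times_divide_eq_right)
    have "\<bar>w t - w (t - r)\<bar> \<le> 2 * M" using bounded[of t] bounded[of "t - r"] by linarith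
    then have 2: "\<bar>w t - w (t - r)\<bar> / r powr (\<gamma> + 1) \<le> 2 * M * r powr (- \<gamma> - 1)"
      using powr_minus_divide[of r "\<gamma> + 1"] by (simp add: divide_right_mono)
    show ?thesis
      using 1 2 False C_nonneg M_nonneg by (auto simp: majorant_def abs_mult indicator_def add_increasing2 add_increasing)
  qed
qed

lemma integrable_quotient:
  "set_integrable lborel {0..} (\<lambda>r. (w t - w (t - r)) / r powr (\<gamma> + 1))"
  unfolding set_integrable_def
proof (rule Bochner_Integration.integrable_bound[OF integrable_majorant])
  show "AE r in lborel. norm (indicat_real {0..} r *\<^sub>R ((w t - w (t - r)) / r powr (\<gamma> + 1))) \<le> norm (majorant r)"
    unfolding real_norm_def real_scaleR_def by (intro AE_I2 order_trans[OF quotient_le_majorant abs_ge_self])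
qed measurable

text \<open>The integrand is continuous in \<open>t\<close> for each \<open>r\<close>, and
  \<open>majorant\<close> does not depend on \<open>t\<close>, so it dominates along every
  convergent sequence.\<close>

lemma continuous_marchaud: "continuous_on A (marchaud \<gamma> w)"
proof -
  have "continuous_on UNIV (marchaud \<gamma> w)"
    unfolding continuous_on_sequentially
  proof (intro allI ballI impI, elim conjE)
    fix t :: real and x assume x: "x \<longlonglongrightarrow> t"
    have w: "(\<lambda>n. w (g n)) \<longlonglongrightarrow> w l" if "g \<longlonglongrightarrow> l" for g l
      using continuous[of UNIV] that by (auto simp: continuous_on_sequentially o_def)
    show "(marchaud \<gamma> w \<circ> x) \<longlonglongrightarrow> marchaud \<gamma> w t"
      unfolding o_def marchaud_def set_lebesgue_integral_def
    proof (rule integral_dominated_convergence[OF _ _ integrable_majorant])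
      show "AE r in lborel. (\<lambda>n. indicat_real {0..} r *\<^sub>R ((w (x n) - w (x n - r)) / r powr (\<gamma> + 1)))
          \<longlonglongrightarrow> indicat_real {0..} r *\<^sub>R ((w t - w (t - r)) / r powr (\<gamma> + 1))"
        using x unfolding divide_inverse
        by (intro AE_I2 tendsto_scaleR tendsto_mult tendsto_diff tendsto_const w)
      show "\<And>n. AE r in lborel. norm (indicat_real {0..} r *\<^sub>R ((w (x n) - w (x n - r)) / r powr (\<gamma> + 1))) \<le> majorant r"
        using quotient_le_majorant by auto
    qed measurable
  qed
  then show ?thesis by (rule continuous_on_subset) simp
qed

lemma set_integral_marchaud:
  assumes "0 \<le> t"
  shows "\<gamma> * (LBINT \<tau>:{0..t}. marchaud \<gamma> w \<tau>) = (LBINT s:{0..t}. (t - s) powr (- \<gamma>) * w s)"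
proof -
  \<comment> \<open>Both double integrals agree after integrating out the time variable: the difference of \<open>w\<close>
    and its translate by \<open>r\<close> integrates over \<open>[0, t)\<close> to the integral of \<open>w\<close> over \<open>[t - r, t)\<close>.\<close>
  define Q where "Q = (\<lambda>\<tau> r. indicat_real {0..<t} \<tau> *
    (indicat_real {0..} r * ((w \<tau> - w (\<tau> - r)) / r powr (\<gamma> + 1))))"
  \<comment> \<open>\<open>v\<close> is \<open>w\<close> on \<open>[0, t)\<close> read backwards
    through \<open>\<rho> = t - \<tau>\<close>.\<close>
  define v where "v = (\<lambda>\<rho>. indicat_real {0<..t} \<rho> * w (t - \<rho>))"
  \<comment> \<open>Over \<open>\<rho>\<close>, \<open>R\<close> integrates to
    \<open>r powr (- \<gamma> - 1)\<close> times the integral of \<open>v\<close> up to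
    \<open>r\<close>, matching \<open>Q\<close>; over \<open>r\<close> it integrates to
    \<open>v \<rho>\<close> times the Abel kernel.\<close>
  define R where "R = (\<lambda>\<rho> r. v \<rho> * (indicat_real {\<rho>..} r * r powr (- \<gamma> - 1)))"
  have v[measurable]: "v \<in> borel_measurable borel" unfolding v_def by measurable
  have integrable_v: "integrable lborel v"
  proof -
    have "set_integrable lborel {0..t} (\<lambda>\<rho>. w (t - \<rho>))"
      by (intro borel_integrable_atLeastAtMost' continuous_on_compose2[OF continuous[of UNIV]] continuous_intros) auto
    then have "set_integrable lborel {0<..t} (\<lambda>\<rho>. w (t - \<rho>))"
      by (rule set_integrable_subset) auto
    then show ?thesis by (simp add: v_def set_integrable_def)
  qed
  have Q: "integrable (lborel \<Otimes>\<^sub>M lborel) (case_prod Q)"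
  proof (rule Bochner_Integration.integrable_bound)
    have [measurable]: "majorant \<in> borel_measurable borel"
      using borel_measurable_integrable[OF integrable_majorant] by simp
    show "integrable (lborel \<Otimes>\<^sub>M lborel) (\<lambda>(\<tau>, r). indicat_real {0..<t} \<tau> * majorant r)"
    proof (rule lborel_pair.Fubini_integrable)
      show "AE \<tau> in lborel. integrable lborel (\<lambda>r. case (\<tau>, r) of (\<tau>, r) \<Rightarrow> indicat_real {0..<t} \<tau> * majorant r)"
        using integrable_majorant by simp
    qed (use assms in \<open>simp_all add: abs_mult integrable_real_indicator\<close>)
    show "AE x in lborel \<Otimes>\<^sub>M lborel. norm (case x of (\<tau>, r) \<Rightarrow> Q \<tau> r)
        \<le> norm (case x of (\<tau>, r) \<Rightarrow> indicat_real {0..<t} \<tau> * majorant r)"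
      unfolding Q_def real_norm_def split_beta abs_mult[of "indicat_real {0..<t} _"]
      by (intro AE_I2 mult_left_mono order_trans[OF quotient_le_majorant abs_ge_self]) auto
    show "case_prod Q \<in> borel_measurable (lborel \<Otimes>\<^sub>M lborel)"
      unfolding Q_def by measurable
  qed
  have inner: "(\<integral>\<tau>. Q \<tau> r \<partial>lborel) = (\<integral>\<rho>. R \<rho> r \<partial>lborel)" for r
  proof (cases "0 < r")
    case True
    \<comment> \<open>The translate is reflected with \<open>t + r\<close> in place of
      \<open>t\<close>, so that \<open>\<rho>\<close> runs over \<open>(r, t + r]\<close>; causality
      removes the part \<open>\<rho> > t\<close>.\<close>
    have eq: "indicat_real {0..<t} (t + - 1 * \<rho>) * w (t + - 1 * \<rho>) = v \<rho>"
      "indicat_real {0..<t} (t + r + - 1 * \<rho>) * w (t + r + - 1 * \<rho> - r) = indicat_real {r<..} \<rho> * v \<rho>" for \<rho>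
      using True causal[of "t - \<rho>"] by (auto simp: v_def indicator_def)
    have int: "integrable lborel (\<lambda>\<tau>. indicat_real {0..<t} \<tau> * w (\<tau> - x))" for x
    proof -
      have "set_integrable lborel {0..t} (\<lambda>\<tau>. w (\<tau> - x))"
        by (intro borel_integrable_atLeastAtMost' continuous_on_compose2[OF continuous[of UNIV]] continuous_intros) auto
      then have "set_integrable lborel {0..<t} (\<lambda>\<tau>. w (\<tau> - x))"
        by (rule set_integrable_subset) auto
      then show ?thesis by (simp add: set_integrable_def)
    qed
    have Q': "Q \<tau> r = (indicat_real {0..<t} \<tau> * w (\<tau> - 0) - indicat_real {0..<t} \<tau> * w (\<tau> - r)) * r powr (- \<gamma> - 1)" for \<tau>
    proof -
      have "r powr (- \<gamma> - 1) = 1 / r powr (\<gamma> + 1)" using powr_minus_divide[of r "\<gamma> + 1"] by simp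
      then show ?thesis using True by (simp add: Q_def algebra_simps diff_divide_distrib)
    qed
    have int_tail: "integrable lborel (\<lambda>\<rho>. indicat_real {r<..} \<rho> * v \<rho>)"
      using integrable_mult_indicator[OF _ integrable_v, of "{r<..}"] by simp
    have "(\<integral>\<tau>. Q \<tau> r \<partial>lborel) = ((\<integral>\<tau>. indicat_real {0..<t} \<tau> * w \<tau> \<partial>lborel) -
        (\<integral>\<tau>. indicat_real {0..<t} \<tau> * w (\<tau> - r) \<partial>lborel)) * r powr (- \<gamma> - 1)"
      unfolding Q' using int[of 0] int[of r] by simp
    also have "\<dots> = ((\<integral>\<rho>. v \<rho> \<partial>lborel) - (\<integral>\<rho>. indicat_real {r<..} \<rho> * v \<rho> \<partial>lborel)) * r powr (- \<gamma> - 1)"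
      using lborel_integral_real_affine[of "-1" "\<lambda>\<tau>. indicat_real {0..<t} \<tau> * w \<tau>" t]
        lborel_integral_real_affine[of "-1" "\<lambda>\<tau>. indicat_real {0..<t} \<tau> * w (\<tau> - r)" "t + r"]
      unfolding eq by simp
    also have "\<dots> = (\<integral>\<rho>. (v \<rho> - indicat_real {r<..} \<rho> * v \<rho>) * r powr (- \<gamma> - 1) \<partial>lborel)"
      using integrable_v int_tail by simp
    also have "\<dots> = (\<integral>\<rho>. R \<rho> r \<partial>lborel)"
      by (intro Bochner_Integration.integral_cong) (auto simp: R_def indicator_def)
    finally show ?thesis .
  next
    case False
    then have "Q \<tau> r = 0" for \<tau> by (cases "r = 0") (auto simp: Q_def)
    moreover have "R \<rho> r = 0" for \<rho> using False by (auto simp: R_def v_def indicator_def)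
    ultimately show ?thesis by simp
  qed
  have tail: "integrable lborel (\<lambda>r. R \<rho> r)"
     "(\<integral>r. \<bar>R \<rho> r\<bar> \<partial>lborel) = \<bar>v \<rho>\<bar> * (\<rho> powr (- \<gamma>) / \<gamma>)"
     "(\<integral>r. R \<rho> r \<partial>lborel) = v \<rho> * (\<rho> powr (- \<gamma>) / \<gamma>)" for \<rho>
  proof -
    have *: "integrable lborel (\<lambda>r. R \<rho> r) \<and>
      (\<integral>r. \<bar>R \<rho> r\<bar> \<partial>lborel) = \<bar>v \<rho>\<bar> * (\<rho> powr (- \<gamma>) / \<gamma>) \<and>
      (\<integral>r. R \<rho> r \<partial>lborel) = v \<rho> * (\<rho> powr (- \<gamma>) / \<gamma>)"
    proof (cases "0 < \<rho>")
      case True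
      with set_integral_powr_tail[of "- \<gamma> - 1" \<rho>] gamma show ?thesis
        by (simp add: R_def abs_mult set_integrable_def set_lebesgue_integral_def)
    qed (simp add: R_def v_def)
    then show "integrable lborel (\<lambda>r. R \<rho> r)"
     "(\<integral>r. \<bar>R \<rho> r\<bar> \<partial>lborel) = \<bar>v \<rho>\<bar> * (\<rho> powr (- \<gamma>) / \<gamma>)"
     "(\<integral>r. R \<rho> r \<partial>lborel) = v \<rho> * (\<rho> powr (- \<gamma>) / \<gamma>)" by auto
  qed
  have R: "integrable (lborel \<Otimes>\<^sub>M lborel) (case_prod R)"
  proof (rule lborel_pair.Fubini_integrable)
    show "integrable lborel (\<lambda>\<rho>. \<integral>r. norm (case (\<rho>, r) of (\<rho>, r) \<Rightarrow> R \<rho> r) \<partial>lborel)"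
    proof (rule Bochner_Integration.integrable_bound)
      \<comment> \<open>The bound comes from \<open>tail\<close> and the bound \<open>M\<close> on
        \<open>w\<close>; since \<open>\<gamma> < 1\<close> it is integrable at
        \<open>0\<close>.\<close>
      show "integrable lborel (\<lambda>\<rho>. M / \<gamma> * (indicat_real {0..t} \<rho> *\<^sub>R \<rho> powr (- \<gamma>)))"
        using set_integrable_powr_from_0[of "- \<gamma>" t] gamma by (simp add: set_integrable_def)
      show "AE \<rho> in lborel. norm (\<integral>r. norm (case (\<rho>, r) of (\<rho>, r) \<Rightarrow> R \<rho> r) \<partial>lborel)
        \<le> norm (M / \<gamma> * (indicat_real {0..t} \<rho> *\<^sub>R \<rho> powr (- \<gamma>)))"
        using gamma M_nonneg bounded by (intro AE_I2) (auto simp: tail v_def indicator_def abs_mult divide_right_mono mult_right_mono)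
      show "(\<lambda>\<rho>. \<integral>r. norm (case (\<rho>, r) of (\<rho>, r) \<Rightarrow> R \<rho> r) \<partial>lborel) \<in> borel_measurable lborel"
        by (simp add: tail)
    qed
    \<comment> \<open>The set \<open>{\<rho>..}\<close> varies with \<open>\<rho>\<close>; written
      as the comparison \<open>\<rho> \<le> r\<close>, its indicator is jointly measurable.\<close>
    have "(\<lambda>(\<rho>, r). v \<rho> * ((if \<rho> \<le> r then 1 else 0) * r powr (- \<gamma> - 1))) \<in> borel_measurable (lborel \<Otimes>\<^sub>M lborel)"
      by measurable
    then show "case_prod R \<in> borel_measurable (lborel \<Otimes>\<^sub>M lborel)"
      by (simp add: R_def indicator_def)
  qed (simp add: tail)
  have "(LBINT \<tau>:{0..t}. marchaud \<gamma> w \<tau>) = (LBINT \<tau>:{0..<t}. marchaud \<gamma> w \<tau>)"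
    by (rule set_integral_Icc_Ico[OF assms])
  also have "\<dots> = (\<integral>\<tau>. (\<integral>r. Q \<tau> r \<partial>lborel) \<partial>lborel)"
    unfolding set_lebesgue_integral_def marchaud_def Q_def real_scaleR_def
    by (simp only: integral_mult_right_zero)
  also have "\<dots> = (\<integral>r. (\<integral>\<tau>. Q \<tau> r \<partial>lborel) \<partial>lborel)"
    by (rule lborel_pair.Fubini_integral[OF Q, symmetric])
  also have "\<dots> = (\<integral>r. (\<integral>\<rho>. R \<rho> r \<partial>lborel) \<partial>lborel)"
    by (simp add: inner)
  also have "\<dots> = (\<integral>\<rho>. (\<integral>r. R \<rho> r \<partial>lborel) \<partial>lborel)"
    by (rule lborel_pair.Fubini_integral[OF R])
  also have "\<dots> = (\<integral>\<rho>. v \<rho> * \<rho> powr (- \<gamma>) / \<gamma> \<partial>lborel)"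
    by (simp add: tail)
  also have "\<dots> = (LBINT \<rho>:{0..t}. \<rho> powr (- \<gamma>) * w (t - \<rho>)) / \<gamma>"
  proof -
    have "v \<rho> * \<rho> powr (- \<gamma>) = indicat_real {0..t} \<rho> *\<^sub>R (\<rho> powr (- \<gamma>) * w (t - \<rho>))" for \<rho>
      by (auto simp: v_def indicator_def)
    then show ?thesis unfolding set_lebesgue_integral_def integral_divide_zero by (simp only:)
  qed
  also have "(LBINT \<rho>:{0..t}. \<rho> powr (- \<gamma>) * w (t - \<rho>)) = (LBINT s:{0..t}. (t - s) powr (- \<gamma>) * w s)"
    using set_integral_reflect(2)[of t "\<lambda>\<rho>. \<rho> powr (- \<gamma>) * w (t - \<rho>)"] by simp
  finally show ?thesis using gamma by simp
qed


lemma marchaud_zero: "marchaud \<gamma> w 0 = 0"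
proof -
  have "indicat_real {0..} r *\<^sub>R ((w 0 - w (0 - r)) / r powr (\<gamma> + 1)) = 0" for r
    using causal[of "- r"] causal[of 0] by (auto simp: indicator_def)
  then show ?thesis unfolding marchaud_def set_lebesgue_integral_def by (simp only: Bochner_Integration.integral_zero)
qed

text \<open>Split at \<open>r = t\<close>. Below, reflection gives the integral over
  \<open>s\<close>; from \<open>t\<close> on, \<open>t - r \<le> 0\<close>, so causality leaves
  \<open>w t\<close> times a power tail.\<close>

lemma marchaud_pos:
  assumes "0 < t"
  shows "set_integrable lborel {0..t} (\<lambda>s. (w t - w s) / (t - s) powr (\<gamma> + 1))"
    and "\<gamma> * marchaud \<gamma> w t =
      w t / t powr \<gamma> + \<gamma> * (LBINT s:{0..t}. (w t - w s) / (t - s) powr (\<gamma> + 1))"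
proof -
  let ?q = "\<lambda>r. (w t - w (t - r)) / r powr (\<gamma> + 1)"
  have int: "set_integrable lborel A ?q" if "A \<subseteq> {0..}" "A \<in> sets borel" for A
    using set_integrable_subset[OF integrable_quotient] that by auto
  show "set_integrable lborel {0..t} (\<lambda>s. (w t - w s) / (t - s) powr (\<gamma> + 1))"
    using int[of "{0..t}"] set_integral_reflect(1)[of t ?q] by simp
  have "marchaud \<gamma> w t = (LBINT r:{0..<t} \<union> {t..}. ?q r)"
    unfolding marchaud_def using assms by (intro arg_cong[where f = "\<lambda>A. LBINT r:A. ?q r"]) auto
  also have "\<dots> = (LBINT r:{0..<t}. ?q r) + (LBINT r:{t..}. ?q r)"
    using assms by (intro set_integral_Un int) auto
  also have "(LBINT r:{0..<t}. ?q r) = (LBINT s:{0..t}. (w t - w s) / (t - s) powr (\<gamma> + 1))"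
    using set_integral_reflect(2)[of t ?q] set_integral_Icc_Ico[of 0 t ?q] assms by simp
  also have "(LBINT r:{t..}. ?q r) = (LBINT r:{t..}. w t * r powr (- \<gamma> - 1))"
  proof (rule set_lebesgue_integral_cong)
    show "\<forall>r. r \<in> {t..} \<longrightarrow> ?q r = w t * r powr (- \<gamma> - 1)"
      using causal powr_minus_divide[of _ "\<gamma> + 1"] by auto
  qed simp
  also have "\<dots> = w t * (t powr (- \<gamma>) / \<gamma>)"
    using set_integral_powr_tail(2)[of "- \<gamma> - 1" t] gamma assms by simp
  finally show "\<gamma> * marchaud \<gamma> w t =
      w t / t powr \<gamma> + \<gamma> * (LBINT s:{0..t}. (w t - w s) / (t - s) powr (\<gamma> + 1))"
    using gamma by (simp add: powr_minus_divide field_simps)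
qed

text \<open>The singular kernel is never differentiated: \<open>set_integral_marchaud\<close>
  exhibits this integral as an antiderivative of a continuous function.\<close>

lemma fractional_integral_has_derivative:
  assumes "t \<in> {0..b}"
  shows "((\<lambda>x. LBINT s:{0..x}. (x - s) powr (- \<gamma>) * w s) has_real_derivative \<gamma> * marchaud \<gamma> w t)
    (at t within {0..b})"
proof -
  have "((\<lambda>x. integral {0..x} (\<lambda>\<tau>. \<gamma> * marchaud \<gamma> w \<tau>)) has_real_derivative \<gamma> * marchaud \<gamma> w t)
      (at t within {0..b})"
    using assms by (intro integral_has_real_derivative continuous_intros continuous_marchaud)
  moreover have "integral {0..x} (\<lambda>\<tau>. \<gamma> * marchaud \<gamma> w \<tau>) = (LBINT s:{0..x}. (x - s) powr (- \<gamma>) * w s)"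
    if "x \<in> {0..b}" for x
  proof -
    have "set_integrable lborel {0..x} (marchaud \<gamma> w)"
      by (intro borel_integrable_atLeastAtMost' continuous_marchaud)
    from set_borel_integral_eq_integral(2)[OF this] set_integral_marchaud[of x] that
    show ?thesis by simp
  qed
  ultimately show ?thesis
    by (rule has_field_derivative_transform_within[OF _ zero_less_one assms]) auto
qed

end

section \<open>Transfer to \<open>\<phi>\<close> on a compact interval\<close>

text \<open>Clamping to \<open>[0, b]\<close> is 1-Lipschitz, so it keeps the Hoelder constant. It
  sends \<open>x \<le> 0\<close> to \<open>0\<close>, which gives causality, and its values are
  within \<open>b\<close> of \<open>0\<close>, which gives the bound.\<close>

lemma truncated_bounded_causal_holder:
  assumes "0 < \<gamma>" "\<gamma> < 1" "\<gamma> < \<alpha>" "0 < b"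
    and "\<And>x y. x \<in> {0..b} \<Longrightarrow> y \<in> {0..b} \<Longrightarrow> \<bar>\<phi> x - \<phi> y\<bar> \<le> C * \<bar>x - y\<bar> powr \<alpha>"
  shows "bounded_causal_holder \<gamma> \<alpha> C (C * b powr \<alpha>) (\<lambda>x. \<phi> (max 0 (min b x)) - \<phi> 0)"
proof
  have "\<bar>\<phi> b - \<phi> 0\<bar> \<le> C * b powr \<alpha>" using assms(5)[of b 0] assms(4) by simp
  then have "0 \<le> C * b powr \<alpha>" by linarith
  then have C: "0 \<le> C" using assms(4) by (simp add: zero_le_mult_iff)
  fix x y
  have "\<bar>\<phi> (max 0 (min b x)) - \<phi> (max 0 (min b y))\<bar>
      \<le> C * \<bar>max 0 (min b x) - max 0 (min b y)\<bar> powr \<alpha>"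
    using assms(4) by (intro assms(5)) auto
  also have "\<dots> \<le> C * \<bar>x - y\<bar> powr \<alpha>"
    using assms C by (intro mult_left_mono powr_mono2) auto
  finally show "\<bar>\<phi> (max 0 (min b x)) - \<phi> 0 - (\<phi> (max 0 (min b y)) - \<phi> 0)\<bar> \<le> C * \<bar>x - y\<bar> powr \<alpha>"
    by simp
  have "\<bar>\<phi> (max 0 (min b x)) - \<phi> 0\<bar> \<le> C * \<bar>max 0 (min b x) - 0\<bar> powr \<alpha>"
    using assms(4) by (intro assms(5)) auto
  also have "\<dots> \<le> C * b powr \<alpha>"
    using assms C by (intro mult_left_mono powr_mono2) auto
  finally show "\<bar>\<phi> (max 0 (min b x)) - \<phi> 0\<bar> \<le> C * b powr \<alpha>" .
qed (use assms in \<open>auto simp: min_def max_def\<close>)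

definition caputo_fun :: "real \<Rightarrow> (real \<Rightarrow> real) \<Rightarrow> real \<Rightarrow> real" where
  "caputo_fun \<gamma> \<phi> t = 1 / Gamma (1 - \<gamma>) *
     ((\<phi> t - \<phi> 0) / t powr \<gamma> + \<gamma> * (LBINT s:{0..t}. (\<phi> t - \<phi> s) / (t - s) powr (\<gamma> + 1)))"

text \<open>
  With \<open>x / 0 = 0\<close> the formula has the correct limiting value at \<open>t = 0\<close>, so no case
  distinction is needed for the continuous representative.
\<close>

lemma caputo_fun_zero: "caputo_fun \<gamma> \<phi> 0 = 0"
proof -
  have "indicat_real {0..0} s *\<^sub>R ((\<phi> 0 - \<phi> s) / (0 - s) powr (\<gamma> + 1)) = 0" for s
    by (auto simp: indicator_def)
  then have "(LBINT s:{0..0}. (\<phi> 0 - \<phi> s) / (0 - s) powr (\<gamma> + 1)) = 0"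
    unfolding set_lebesgue_integral_def by (simp only: Bochner_Integration.integral_zero)
  then show ?thesis by (simp add: caputo_fun_def)
qed

text \<open>All four claims rest on one truncation \<open>w\<close>, which equals
  \<open>\<phi> - \<phi> 0\<close> on \<open>[0, b]\<close> and so has the same differences there.
  Continuity reaches the endpoints, but the derivative stays in the interior: for
  \<open>\<phi> 0 \<noteq> 0\<close> the constant part contributes a multiple of
  \<open>t powr (1 - \<gamma>)\<close>, of infinite slope at \<open>0\<close>.\<close>

lemma
  assumes "0 < \<gamma>" "\<gamma> < 1" "\<gamma> < \<alpha>" "0 < b"
    and "\<And>x y. x \<in> {0..b} \<Longrightarrow> y \<in> {0..b} \<Longrightarrow> \<bar>\<phi> x - \<phi> y\<bar> \<le> C * \<bar>x - y\<bar> powr \<alpha>"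
  shows caputo_fun_integrable: "t \<in> {0<..b} \<Longrightarrow>
      set_integrable lborel {0..t} (\<lambda>s. (\<phi> t - \<phi> s) / (t - s) powr (\<gamma> + 1))"
    and continuous_on_caputo_fun: "continuous_on {0..b} (caputo_fun \<gamma> \<phi>)"
    and continuous_on_abel_integral: "continuous_on {0..b} (abel_integral \<gamma> \<phi>)"
    and abel_integral_has_derivative: "t \<in> {0<..<b} \<Longrightarrow>
      (abel_integral \<gamma> \<phi> has_real_derivative
        caputo_fun \<gamma> \<phi> t + \<phi> 0 * g_kernel (1 - \<gamma>) t) (at t)"
proof -
  define w where "w = (\<lambda>x. \<phi> (max 0 (min b x)) - \<phi> 0)"
  interpret bounded_causal_holder \<gamma> \<alpha> C "C * b powr \<alpha>" w
    unfolding w_def by (rule truncated_bounded_causal_holder[OF assms])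
  have w: "w x = \<phi> x - \<phi> 0" if "x \<in> {0..b}" for x using that by (simp add: w_def)
  have quotient: "(w t - w s) / (t - s) powr (\<gamma> + 1) = (\<phi> t - \<phi> s) / (t - s) powr (\<gamma> + 1)"
    if "t \<in> {0..b}" "s \<in> {0..t}" for t s
    using that by (simp add: w)
  show "set_integrable lborel {0..t} (\<lambda>s. (\<phi> t - \<phi> s) / (t - s) powr (\<gamma> + 1))" if "t \<in> {0<..b}" for t
    using marchaud_pos(1)[of t] quotient[of t] that
    by (subst set_integrable_cong[OF refl refl quotient[symmetric]]) auto
  have f: "caputo_fun \<gamma> \<phi> t = 1 / Gamma (1 - \<gamma>) * (\<gamma> * marchaud \<gamma> w t)" if "t \<in> {0..b}" for t
  proof (cases "t = 0")
    case True
    then show ?thesis by (simp add: caputo_fun_zero marchaud_zero)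
  next
    case False
    have "(LBINT s:{0..t}. (w t - w s) / (t - s) powr (\<gamma> + 1)) =
        (LBINT s:{0..t}. (\<phi> t - \<phi> s) / (t - s) powr (\<gamma> + 1))"
      using quotient[OF that] by (intro set_lebesgue_integral_cong) auto
    with False that marchaud_pos(2)[of t] w[of t] show ?thesis
      by (simp add: caputo_fun_def)
  qed
  have "continuous_on {0..b} (\<lambda>t. 1 / Gamma (1 - \<gamma>) * (\<gamma> * marchaud \<gamma> w t))"
    by (intro continuous_intros continuous_marchaud)
  then show "continuous_on {0..b} (caputo_fun \<gamma> \<phi>)"
    by (subst continuous_on_cong[OF refl f])
  define P where "P = (\<lambda>t. LBINT s:{0..t}. (t - s) powr (- \<gamma>) * w s)"
  \<comment> \<open>The Abel integral of \<open>\<phi> = w + \<phi> 0\<close>, with the constant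
    part evaluated in closed form.\<close>
  define H where "H = (\<lambda>t. 1 / Gamma (1 - \<gamma>) * (P t + \<phi> 0 * (t powr (1 - \<gamma>) / (1 - \<gamma>))))"
  have abel: "abel_integral \<gamma> \<phi> t = H t" if t: "t \<in> {0..b}" for t
  proof (cases "t = 0")
    case True
    have "indicat_real {0..0} s *\<^sub>R ((0 - s) powr (- \<gamma>) * w s) = 0" for s
      by (auto simp: indicator_def)
    then have "P 0 = 0"
      unfolding P_def set_lebesgue_integral_def by (simp only: Bochner_Integration.integral_zero)
    then show ?thesis using True gamma by (simp add: abel_integral_def H_def)
  next
    case False
    have k: "set_integrable lborel {0..t} (\<lambda>s. (t - s) powr (- \<gamma>))"
      using set_integral_reflect(1)[of t "\<lambda>r. r powr (- \<gamma>)"] set_integrable_powr_from_0[of "- \<gamma>" t] gamma by simp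
    have kv: "(LBINT s:{0..t}. (t - s) powr (- \<gamma>)) = t powr (1 - \<gamma>) / (1 - \<gamma>)"
      using set_integral_reflect(2)[of t "\<lambda>r. r powr (- \<gamma>)"] gamma t
        set_borel_integral_eq_integral(2)[OF set_integrable_powr_from_0[of "- \<gamma>" t]]
        integral_unique[OF has_integral_powr_from_0[of "- \<gamma>" t]] by simp
    have kw: "set_integrable lborel {0..t} (\<lambda>s. (t - s) powr (- \<gamma>) * w s)"
    proof -
      have "integrable lborel (\<lambda>s. indicat_real {0..t} s *\<^sub>R ((t - s) powr (- \<gamma>) * w s))"
      proof (rule Bochner_Integration.integrable_bound)
        show "integrable lborel (\<lambda>s. C * b powr \<alpha> * (indicat_real {0..t} s *\<^sub>R (t - s) powr (- \<gamma>)))"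
          using k by (simp add: set_integrable_def)
        show "AE s in lborel. norm (indicat_real {0..t} s *\<^sub>R ((t - s) powr (- \<gamma>) * w s)) \<le>
            norm (C * b powr \<alpha> * (indicat_real {0..t} s *\<^sub>R (t - s) powr (- \<gamma>)))"
          using bounded C_nonneg by (intro AE_I2) (auto simp: indicator_def abs_mult mult.commute mult_right_mono)
      qed measurable
      then show ?thesis by (simp add: set_integrable_def)
    qed
    have "(LBINT s:{0..t}. (t - s) powr (- \<gamma>) * \<phi> s) =
        (LBINT s:{0..t}. (t - s) powr (- \<gamma>) * w s + \<phi> 0 * (t - s) powr (- \<gamma>))"
      using t by (intro set_lebesgue_integral_cong) (auto simp: w algebra_simps)
    also have "\<dots> = P t + \<phi> 0 * (t powr (1 - \<gamma>) / (1 - \<gamma>))"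
      using kw k by (subst set_integral_add(2)) (auto simp: P_def kv)
    finally show ?thesis using False t by (simp add: abel_integral_def H_def)
  qed
  have "continuous_on {0..b} P"
    unfolding P_def by (rule DERIV_continuous_on[OF fractional_integral_has_derivative])
  then have "continuous_on {0..b} H"
    unfolding H_def using gamma by (intro continuous_intros continuous_on_powr') auto
  then show "continuous_on {0..b} (abel_integral \<gamma> \<phi>)"
    by (subst continuous_on_cong[OF refl abel])
  show "(abel_integral \<gamma> \<phi> has_real_derivative
        caputo_fun \<gamma> \<phi> t + \<phi> 0 * g_kernel (1 - \<gamma>) t) (at t)" if t: "t \<in> {0<..<b}" for t
  proof -
    have "(P has_real_derivative \<gamma> * marchaud \<gamma> w t) (at t)"
      using fractional_integral_has_derivative[of t b] t at_within_Icc_at[of 0 t b] by (simp add: P_def)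
    then have "(H has_real_derivative 1 / Gamma (1 - \<gamma>) *
        (\<gamma> * marchaud \<gamma> w t + \<phi> 0 * ((1 - \<gamma>) * t powr (1 - \<gamma> - 1) / (1 - \<gamma>)))) (at t)"
      unfolding H_def using t by (intro DERIV_cmult DERIV_add DERIV_cdivide has_real_derivative_powr) auto
    \<comment> \<open>After cancelling \<open>1 - \<gamma>\<close>, the power divided by
      \<open>Gamma (1 - \<gamma>)\<close> is exactly
      \<open>g_kernel (1 - \<gamma>) t\<close>.\<close>
    then have "(H has_real_derivative caputo_fun \<gamma> \<phi> t + \<phi> 0 * g_kernel (1 - \<gamma>) t) (at t)"
      using gamma t by (simp add: f g_kernel_def distrib_left)
    then show ?thesis
      by (rule has_field_derivative_transform_within_open[of _ _ _ "{0<..<b}"]) (use t abel in auto)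
  qed
qed

section \<open>Pairing with test functions\<close>

text \<open>\<open>F\<close> cuts off the left of \<open>0\<close> and \<open>\<eta>\<close> the
  right of \<open>b\<close>, so every pairing reduces to a compact interval inside
  \<open>U\<close>.\<close>

lemma set_integral_causal:
  fixes F \<eta> :: "real \<Rightarrow> real"
  assumes "{0..b} \<subseteq> U" "\<And>x. x < 0 \<Longrightarrow> F x = 0" "\<And>x. b < x \<Longrightarrow> \<eta> x = 0"
  shows "(LBINT x:U. F x * \<eta> x) = (LBINT x:{0..b}. F x * \<eta> x)"
proof -
  have "indicat_real U x *\<^sub>R (F x * \<eta> x) = indicat_real {0..b} x *\<^sub>R (F x * \<eta> x)" for x
    using assms by (cases "x < 0"; cases "b < x") (auto simp: indicator_def subset_iff)
  then show ?thesis unfolding set_lebesgue_integral_def by (simp only:)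
qed

lemma Icc_subset_ray_below: "ereal b < T \<Longrightarrow> {0..b} \<subseteq> ray_below T"
  by (auto simp: ray_below_def intro: le_less_trans[of _ "ereal b"])

text \<open>Integration by parts moves the derivative from the test function to the Abel integral;
  the term \<open>\<phi> 0 * g_kernel (1 - \<gamma>)\<close> in its derivative cancels the one
  subtracted in \<open>caputo_deriv\<close>.\<close>

lemma caputo_deriv_eq_regular_dist:
  assumes "0 < T" "0 < \<gamma>" "\<gamma> < 1" "\<gamma> < \<alpha>" "\<phi> \<in> holder_space \<alpha> (time_interval T)"
  shows "caputo_deriv \<gamma> T \<phi> = regular_dist (ray_below T) (extend_by_zero (caputo_fun \<gamma> \<phi>))"
  unfolding caputo_deriv_def regular_dist_def J_neg_def dist_deriv_def
proof (rule restrict_ext)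
  fix \<psi> assume \<psi>: "\<psi> \<in> test_functions (ray_below T)"
  obtain C where C: "\<And>x y. x \<in> time_interval T \<Longrightarrow> y \<in> time_interval T \<Longrightarrow>
      \<bar>\<phi> x - \<phi> y\<bar> \<le> C * \<bar>x - y\<bar> powr \<alpha>"
    using assms(5) unfolding holder_space_def by blast
  obtain K where K: "smooth \<psi>" "compact K" "K \<subseteq> ray_below T" "\<forall>x. x \<notin> K \<longrightarrow> \<psi> x = 0"
    using \<psi> unfolding test_functions_def by blast
  obtain a b0 where ab0: "K \<subseteq> {a..b0}" "0 < b0" "ereal b0 < T"
    using ray_below_compactE[OF K(2,3) assms(1)] .
  \<comment> \<open>The support may touch \<open>b0\<close>; a strictly larger \<open>b\<close>
    makes \<open>\<psi>\<close> and \<open>deriv \<psi>\<close> vanish at the endpoint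
    itself.\<close>
  obtain b where b: "b0 < b" "ereal b < T"
    using ereal_dense2[OF ab0(3)] by auto
  have sub: "{0..b} \<subseteq> time_interval T"
    using Icc_subset_ray_below[OF b(2)] by (auto simp: time_interval_def ray_below_def)
  have \<psi>0: "\<psi> x = 0" "deriv \<psi> x = 0" if "b \<le> x" for x
    using K(4) deriv_zero_outside[OF K(2,4)] ab0 b that by force+
  note hyps = assms(2-4) less_trans[OF ab0(2) b(1)] C[OF subsetD[OF sub] subsetD[OF sub]]
  let ?A = "abel_integral \<gamma> \<phi>" and ?f = "caputo_fun \<gamma> \<phi>" and ?g = "g_kernel (1 - \<gamma>)"
  have cont: "continuous_on A \<psi>" "continuous_on A (deriv \<psi>)" for A
    using \<psi> test_functions_deriv[OF \<psi>] test_function_continuous by blast+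
  have int: "set_integrable lborel {0..b} (\<lambda>x. ?A x * deriv \<psi> x)"
    "set_integrable lborel {0..b} (\<lambda>x. ?f x * \<psi> x)"
    using continuous_on_abel_integral[OF hyps] continuous_on_caputo_fun[OF hyps] cont
    by (auto intro!: borel_integrable_atLeastAtMost' continuous_on_mult)
  have intg: "set_integrable lborel {0..b} (\<lambda>x. ?g x * \<psi> x)"
    using test_pairing(1)[OF g_kernel_locally_integrable[OF _ K(2)] K(2,3) \<psi> K(4), of "1 - \<gamma>"] assms(3)
    by (rule_tac set_integrable_subset[OF _ _ Icc_subset_ray_below[OF b(2)]]) auto
  have "((\<lambda>x. ?A x * deriv \<psi> x + (?f x + \<phi> 0 * ?g x) * \<psi> x) has_integral ?A b * \<psi> b - ?A 0 * \<psi> 0) {0..b}"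
  \<comment> \<open>The interior version suits the singularity of \<open>g_kernel\<close> at
    \<open>0\<close>: the product is continuous up to the endpoints and differentiable between
    them.\<close>
  proof (rule fundamental_theorem_of_calculus_interior)
    show "continuous_on {0..b} (\<lambda>x. ?A x * \<psi> x)"
      by (intro continuous_on_mult continuous_on_abel_integral[OF hyps] cont)
    fix x assume x: "x \<in> {0<..<b}"
    have "\<psi> differentiable at x" using K(1) unfolding smooth_def by (auto dest: spec[of _ 0])
    then have "(\<psi> has_real_derivative deriv \<psi> x) (at x)"
      by (metis DERIV_imp_deriv real_differentiableE)
    from DERIV_mult[OF abel_integral_has_derivative[OF hyps x] this]
    show "((\<lambda>x. ?A x * \<psi> x) has_vector_derivative ?A x * deriv \<psi> x + (?f x + \<phi> 0 * ?g x) * \<psi> x) (at x)"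
      by (simp add: has_real_derivative_iff_has_vector_derivative[symmetric] ac_simps)
  qed (use hyps in simp)
  \<comment> \<open>This removes the boundary term at \<open>0\<close>, where \<open>\<psi>\<close>
    need not vanish; \<open>\<psi> b = 0\<close> removes the other.\<close>
  moreover have "?A 0 = 0" by (simp add: abel_integral_def)
  ultimately have "integral {0..b} (\<lambda>x. ?A x * deriv \<psi> x + (?f x * \<psi> x + \<phi> 0 * (?g x * \<psi> x))) = 0"
    using \<psi>0(1)[of b] by (simp add: integral_unique algebra_simps)
  moreover have "set_integrable lborel {0..b} (\<lambda>x. \<phi> 0 * (?g x * \<psi> x))"
    using intg by simp
  note add = set_integral_add[OF int(2) this]
  ultimately have parts: "(LBINT x:{0..b}. ?A x * deriv \<psi> x) +
      ((LBINT x:{0..b}. ?f x * \<psi> x) + \<phi> 0 * (LBINT x:{0..b}. ?g x * \<psi> x)) = 0"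
    using set_borel_integral_eq_integral(2)[OF set_integral_add(1)[OF int(1) add(1)]]
    by (simp add: set_integral_add(2)[OF int(1) add(1)] add(2))
  have ext: "(LBINT x:{0..b}. extend_by_zero ?f x * \<psi> x) = (LBINT x:{0..b}. ?f x * \<psi> x)"
    by (intro set_lebesgue_integral_cong) (auto simp: extend_by_zero_def)
  note causal = set_integral_causal[OF Icc_subset_ray_below[OF b(2)]]
  have "(LBINT x:ray_below T. ?A x * deriv \<psi> x) = (LBINT x:{0..b}. ?A x * deriv \<psi> x)"
    "(LBINT x:ray_below T. ?g x * \<psi> x) = (LBINT x:{0..b}. ?g x * \<psi> x)"
    "(LBINT x:ray_below T. extend_by_zero ?f x * \<psi> x) = (LBINT x:{0..b}. ?f x * \<psi> x)"
    unfolding ext[symmetric] using \<psi>0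
    by (auto intro!: causal simp: abel_integral_def g_kernel_def extend_by_zero_def)
  then show "(\<lambda>\<psi>\<in>test_functions (ray_below T). - (\<lambda>\<psi>\<in>test_functions (ray_below T). LBINT x:ray_below T. ?A x * \<psi> x) (deriv \<psi>)) \<psi>
      - \<phi> 0 * (\<lambda>\<psi>\<in>test_functions (ray_below T). LBINT x:ray_below T. ?g x * \<psi> x) \<psi>
      = (LBINT x:ray_below T. extend_by_zero ?f x * \<psi> x)"
    using parts \<psi> test_functions_deriv[OF \<psi>] by simp
qed

section \<open>Passage from the intervals \<open>[0, b]\<close> to \<open>[0, T)\<close>\<close>

theorem corollary3p12:
  fixes T :: ereal and \<gamma> :: real and \<phi> :: "real \<Rightarrow> real"
  assumes "0 < T" and "0 < \<gamma>" and "\<gamma> < 1"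
    and "\<exists>\<delta>>0. \<phi> \<in> holder_space (\<gamma> + \<delta>) (time_interval T)"
  shows "\<exists>f. continuous_on (time_interval T) f \<and>
    caputo_deriv \<gamma> T \<phi> = regular_dist (ray_below T) (extend_by_zero f) \<and>
    (let rhs = (\<lambda>t. 1 / Gamma (1 - \<gamma>) *
           ((\<phi> t - \<phi> 0) / t powr \<gamma> +
            \<gamma> * (LBINT s:{0..t}. (\<phi> t - \<phi> s) / (t - s) powr (\<gamma> + 1))))
     in (\<forall>t\<in>time_interval T. 0 < t \<longrightarrow>
           set_integrable lborel {0..t} (\<lambda>s. (\<phi> t - \<phi> s) / (t - s) powr (\<gamma> + 1)) \<and>
           f t = rhs t) \<and>
        (rhs \<longlongrightarrow> f 0) (at_right 0))"
proof -
  obtain \<delta> where \<delta>: "0 < \<delta>" and \<phi>: "\<phi> \<in> holder_space (\<gamma> + \<delta>) (time_interval T)"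
    using assms(4) by blast
  obtain C where C: "\<And>x y. x \<in> time_interval T \<Longrightarrow> y \<in> time_interval T \<Longrightarrow>
      \<bar>\<phi> x - \<phi> y\<bar> \<le> C * \<bar>x - y\<bar> powr (\<gamma> + \<delta>)"
    using \<phi> unfolding holder_space_def by blast
  have sub: "{0..b} \<subseteq> time_interval T" if "ereal b < T" for b
    using Icc_subset_ray_below[OF that] by (auto simp: time_interval_def ray_below_def)
  have holder: "\<bar>\<phi> x - \<phi> y\<bar> \<le> C * \<bar>x - y\<bar> powr (\<gamma> + \<delta>)"
    if "ereal b < T" "x \<in> {0..b}" "y \<in> {0..b}" for b x y
    using C sub[OF that(1)] that by blast
  have \<gamma>\<delta>: "\<gamma> < \<gamma> + \<delta>" using \<delta> by simp
  let ?f = "caputo_fun \<gamma> \<phi>"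
  have cont: "continuous_on {0..b} ?f" if "0 < b" "ereal b < T" for b
    by (rule continuous_on_caputo_fun[OF assms(2,3) \<gamma>\<delta> that(1) holder[OF that(2)]])
  have "continuous_on (time_interval T) ?f"
    unfolding continuous_on_eq_continuous_within
  proof
    fix t assume t: "t \<in> time_interval T"
    then obtain b where b: "t < b" "ereal b < T"
      using ereal_dense2[of "ereal t" T] by (auto simp: time_interval_def)
    have "continuous (at t within {0..b}) ?f"
      using cont[of b] b t by (auto simp: continuous_on_eq_continuous_within time_interval_def)
    \<comment> \<open>Continuity is local: inside the neighbourhood \<open>{..<b}\<close> of
      \<open>t\<close> the two sets coincide.\<close>
    moreover have "at t within time_interval T = at t within {0..b}"
      using b sub[OF b(2)] by (intro at_within_nhd[of t "{..<b}"]) (auto simp: time_interval_def)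
    ultimately show "continuous (at t within time_interval T) ?f" by simp
  qed
  moreover have "set_integrable lborel {0..t} (\<lambda>s. (\<phi> t - \<phi> s) / (t - s) powr (\<gamma> + 1))"
    if "t \<in> time_interval T" "0 < t" for t
  proof -
    have "ereal t < T" using that by (simp add: time_interval_def)
    \<comment> \<open>The compact interval is taken with \<open>b = t\<close>, as the integrability
      claim includes the right endpoint.\<close>
    from caputo_fun_integrable[OF assms(2,3) \<gamma>\<delta> that(2) holder[OF this], of t] that(2)
    show ?thesis by simp
  qed
  moreover have "(?f \<longlongrightarrow> ?f 0) (at_right 0)"
  proof -
    obtain b where b: "0 < b" "ereal b < T"
      using ereal_dense2[OF assms(1)] by (auto simp: zero_ereal_def)
    have "(?f \<longlongrightarrow> ?f 0) (at 0 within {0..b})"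
      using cont[OF b] b by (auto simp: continuous_on_def)
    then show ?thesis using at_within_Icc_at_right[OF b(1)] by simp
  qed
  ultimately show ?thesis
    using caputo_deriv_eq_regular_dist[OF assms(1-3) \<gamma>\<delta> \<phi>]
    unfolding Let_def caputo_fun_def[of \<gamma> \<phi>, symmetric] by (intro exI[of _ ?f]) simp
qed

end
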